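(* Let $D^-\subseteq\mathbb{F}_4^{11}$ be the additive code defined in the context. Then $D^-$ is uniformly packed (with packing radius $e=2$, minimum distance $5$) with packing constants $(\lambda,\mu)=(4,5)$; that is, for every $x\in\mathbb{F}_4^{11}$, the number of codewords of $D^-$ at Hamming distance $3$ from $x$ equals $4$ if $x$ is at distance exactly $2$ from $D^-$, and equals $5$ if $x$ is at distance at least $3$ from $D^-$.
   Context: $\mathbb{F}_4=\{0,1,\omega,\omega^2\}$ with $\omega^2=\omega+1$. An additive code of length $n$ over $\mathbb{F}_4$ is an additive subgroup of $\mathbb{F}_4^n$ (equivalently an $\mathbb{F}_2$-subspace). Distances and weights are Hamming. $D^-$ is the $\mathbb{F}_2$-span of the following $12$ vectors of $\mathbb{F}_4^{11}$ (it is equivalent to the code obtained by puncturing the dodecacode, an additive $(12,4^6,6)$ code, in any coordinate): $(0,0,0,0,0,\omega^2,\omega^2,0,\omega,1,\omega)$, $(0,0,0,0,0,\omega,0,\omega,\omega,\omega,1)$, $(1,0,0,0,0,1,0,1,\omega^2,\omega^2,1)$, $(\omega,0,0,0,0,0,\omega,1,\omega,\omega,\omega)$, $(0,1,0,0,0,0,1,1,1,\omega^2,\omega^2)$, $(0,\omega,0,0,0,\omega^2,1,\omega^2,\omega,\omega,0)$, $(0,0,1,0,0,\omega,\omega,1,1,0,1)$, $(0,0,\omega,0,0,\omega,1,\omega,\omega^2,\omega^2,0)$, $(0,0,0,1,0,\omega,\omega,\omega,0,1,\omega)$, $(0,0,0,\omega,0,\omega^2,1,1,\omega^2,0,\omega)$,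 $(0,0,0,0,1,\omega^2,\omega^2,\omega^2,1,0,\omega^2)$, $(0,0,0,0,\omega,\omega,1,0,1,\omega,\omega)$. It has $4^6$ codewords and minimum distance $5$. *)

theory Defs
  imports "HOL-Analysis.Analysis" "HOL-Library.Z2"
begin

section \<open>The field with four elements\<close>

text \<open>\<open>GF4 a b\<close> stands for \<open>a + b\<omega>\<close> in \<open>\<F>\<^sub>2[\<omega>]/(\<omega>\<^sup>2 + \<omega> + 1)\<close>. As \<open>x\<^sup>3 = 1\<close> for
  \<open>x \<noteq> 0\<close>, the inverse of \<open>x\<close> is \<open>x\<^sup>2\<close>.\<close>

datatype gf4 = GF4 bit bit

instantiation gf4 :: field
begin

definition zero_gf4 :: gf4 where "0 = GF4 0 0"

definition one_gf4 :: gf4 where "1 = GF4 1 0"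

fun plus_gf4 :: "gf4 \<Rightarrow> gf4 \<Rightarrow> gf4" where
  "GF4 a b + GF4 c d = GF4 (a + c) (b + d)"

definition uminus_gf4 :: "gf4 \<Rightarrow> gf4" where "- x = (x :: gf4)"

definition minus_gf4 :: "gf4 \<Rightarrow> gf4 \<Rightarrow> gf4" where "x - y = x + (y :: gf4)"

fun times_gf4 :: "gf4 \<Rightarrow> gf4 \<Rightarrow> gf4" where
  "GF4 a b * GF4 c d = GF4 (a * c + b * d) (a * d + b * c + b * d)"

definition inverse_gf4 :: "gf4 \<Rightarrow> gf4" where "inverse x = x * (x :: gf4)"

definition divide_gf4 :: "gf4 \<Rightarrow> gf4 \<Rightarrow> gf4" where "x div y = x * inverse (y :: gf4)"

instance
proof
  fix a b c :: gf4
  have bit: "z = 0 \<or> z = 1" for z :: bit by (cases z) auto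
  show "a * b * c = a * (b * c)"
    by (cases a; cases b; cases c) (simp del: add_bit_eq_xor mult_bit_eq_and add: algebra_simps)
  show "a * b = b * a"
    by (cases a; cases b) (simp del: add_bit_eq_xor mult_bit_eq_and add: algebra_simps)
  show "1 * a = a" by (cases a) (simp add: one_gf4_def)
  show "a + b + c = a + (b + c)"
    by (cases a; cases b; cases c) (simp del: add_bit_eq_xor mult_bit_eq_and add: algebra_simps)
  show "a + b = b + a"
    by (cases a; cases b) (simp del: add_bit_eq_xor mult_bit_eq_and add: algebra_simps)
  show "0 + a = a" by (cases a) (simp add: zero_gf4_def)
  show "- a + a = 0" by (cases a) (simp add: zero_gf4_def uminus_gf4_def)
  show "a - b = a + - b" by (simp add: minus_gf4_def uminus_gf4_def)
  show "(a + b) * c = a * c + b * c"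
    by (cases a; cases b; cases c) (simp del: add_bit_eq_xor mult_bit_eq_and add: algebra_simps)
  show "(0 :: gf4) \<noteq> 1" by (simp add: zero_gf4_def one_gf4_def)
  show "inverse a * a = 1" if "a \<noteq> 0"
  proof (cases a)
    case (GF4 x y)
    then show ?thesis using that bit[of x] bit[of y]
      by (auto simp: zero_gf4_def one_gf4_def inverse_gf4_def)
  qed
  show "a div b = a * inverse b" by (simp add: divide_gf4_def)
  show "inverse (0 :: gf4) = 0" by (simp add: inverse_gf4_def zero_gf4_def)
qed

end

definition \<omega> :: gf4 where "\<omega> = GF4 0 1"

lemma omega_square: "\<omega>\<^sup>2 = \<omega> + 1"
  by (simp add: \<omega>_def one_gf4_def power2_eq_square)

lemma UNIV_gf4: "(UNIV :: gf4 set) = {0, 1, \<omega>, \<omega>\<^sup>2}"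
proof -
  have bit: "z = 0 \<or> z = 1" for z :: bit by (cases z) auto
  have "x \<in> {0, 1, \<omega>, \<omega>\<^sup>2}" for x
  proof (cases x)
    case (GF4 a b)
    then show ?thesis using bit[of a] bit[of b]
      by (auto simp: power2_eq_square \<omega>_def zero_gf4_def one_gf4_def)
  qed
  then show ?thesis by auto
qed

instance gf4 :: finite
  by standard (simp add: UNIV_gf4)

section \<open>Codes in the Hamming space\<close>

definition hamming_dist :: "'a ^ 'n \<Rightarrow> 'a ^ 'n \<Rightarrow> nat" where
  "hamming_dist x y = card {i. x $ i \<noteq> y $ i}"

definition dist_to_code :: "'a ^ 'n \<Rightarrow> ('a ^ 'n) set \<Rightarrow> nat" where
  "dist_to_code x C = (INF c\<in>C. hamming_dist x c)"

definition min_distance :: "('a ^ 'n) set \<Rightarrow> nat" where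
  "min_distance C = Inf {hamming_dist x y | x y. x \<in> C \<and> y \<in> C \<and> x \<noteq> y}"

definition packing_radius :: "('a ^ 'n) set \<Rightarrow> nat" where
  "packing_radius C = (min_distance C - 1) div 2"

definition uniformly_packed :: "('a ^ 'n) set \<Rightarrow> nat \<Rightarrow> nat \<Rightarrow> bool" where
  "uniformly_packed C l m \<longleftrightarrow> (let e = packing_radius C in
     \<forall>x. (dist_to_code x C = e \<longrightarrow> card {c \<in> C. hamming_dist x c = e + 1} = l) \<and>
         (dist_to_code x C \<ge> e + 1 \<longrightarrow> card {c \<in> C. hamming_dist x c = e + 1} = m))"

section \<open>The punctured dodecacode\<close>

text \<open>\<open>GF4 b 0\<close> is the image of \<open>b\<close> under the embedding of \<open>\<F>\<^sub>2\<close> into \<open>\<F>\<^sub>4\<close>.\<close>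

definition f2_scale :: "bit \<Rightarrow> gf4 ^ 'n \<Rightarrow> gf4 ^ 'n" where
  "f2_scale b v = GF4 b 0 *s v"

interpretation f2: vector_space "f2_scale :: bit \<Rightarrow> gf4 ^ 'n \<Rightarrow> gf4 ^ 'n"
proof
  fix a b :: bit and x y :: "gf4 ^ 'n"
  show "f2_scale a (x + y) = f2_scale a x + f2_scale a y"
    by (simp add: f2_scale_def vector_add_ldistrib)
  have "GF4 (a + b) 0 = GF4 a 0 + GF4 b 0" by simp
  then show "f2_scale (a + b) x = f2_scale a x + f2_scale b x"
    by (simp only: f2_scale_def vector_sadd_rdistrib)
  have "GF4 (a * b) 0 = GF4 a 0 * GF4 b 0" by simp
  then show "f2_scale a (f2_scale b x) = f2_scale (a * b) x"
    by (simp only: f2_scale_def vector_smult_assoc)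
  show "f2_scale 1 x = x"
    by (simp add: f2_scale_def flip: one_gf4_def)
qed

lemma vector_11:
  fixes x1 x2 x3 x4 x5 x6 x7 x8 x9 x10 x11 :: "'a :: zero"
  defines "v \<equiv> vector [x1, x2, x3, x4, x5, x6, x7, x8, x9, x10, x11] :: 'a ^ 11"
  shows "v $ 1 = x1"
    "v $ 2 = x2"
    "v $ 3 = x3"
    "v $ 4 = x4"
    "v $ 5 = x5"
    "v $ 6 = x6"
    "v $ 7 = x7"
    "v $ 8 = x8"
    "v $ 9 = x9"
    "v $ 10 = x10"
    "v $ 11 = x11"
  unfolding v_def vector_def by simp_all

definition D_generators :: "(gf4 ^ 11) set" where
  "D_generators = {
     vector [0, 0, 0, 0, 0, \<omega>\<^sup>2, \<omega>\<^sup>2, 0, \<omega>, 1, \<omega>],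
     vector [0, 0, 0, 0, 0, \<omega>, 0, \<omega>, \<omega>, \<omega>, 1],
     vector [1, 0, 0, 0, 0, 1, 0, 1, \<omega>\<^sup>2, \<omega>\<^sup>2, 1],
     vector [\<omega>, 0, 0, 0, 0, 0, \<omega>, 1, \<omega>, \<omega>, \<omega>],
     vector [0, 1, 0, 0, 0, 0, 1, 1, 1, \<omega>\<^sup>2, \<omega>\<^sup>2],
     vector [0, \<omega>, 0, 0, 0, \<omega>\<^sup>2, 1, \<omega>\<^sup>2, \<omega>, \<omega>, 0],
     vector [0, 0, 1, 0, 0, \<omega>, \<omega>, 1, 1, 0, 1],
     vector [0, 0, \<omega>, 0, 0, \<omega>, 1, \<omega>, \<omega>\<^sup>2, \<omega>\<^sup>2, 0],
     vector [0, 0, 0, 1, 0, \<omega>, \<omega>, \<omega>, 0, 1, \<omega>],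
     vector [0, 0, 0, \<omega>, 0, \<omega>\<^sup>2, 1, 1, \<omega>\<^sup>2, 0, \<omega>],
     vector [0, 0, 0, 0, 1, \<omega>\<^sup>2, \<omega>\<^sup>2, \<omega>\<^sup>2, 1, 0, \<omega>\<^sup>2],
     vector [0, 0, 0, 0, \<omega>, \<omega>, 1, 0, 1, \<omega>, \<omega>]}"

definition D_minus :: "(gf4 ^ 11) set" where
  "D_minus = f2.span D_generators"

end

theory Submission
  imports Defs "HOL-Computational_Algebra.Polynomial"
begin

text \<open>
  The code \<open>D\<^sup>-\<close> is the symplectic complement of a binary code of dimension 10 in \<open>\<F>\<^sub>4\<^sup>1\<^sup>1\<close>, all of
  whose nonzero words have weight 6, 8 or 10. Expanding the indicator function of \<open>D\<^sup>-\<close> into the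
  characters given by these dual words (the MacWilliams argument, carried out for an arbitrary
  centre \<open>y\<close>) expresses the numbers \<open>N\<^sub>j\<close> of codewords at distance \<open>j\<close> from \<open>y\<close> through the
  Krawtchouk values \<open>K\<^sub>j(w)\<close> at the dual weights \<open>w\<close>. The combination \<open>5 K\<^sub>0 + 5 K\<^sub>1 + K\<^sub>2 + K\<^sub>3\<close>
  vanishes at 6, 8 and 10, so only the trivial character contributes and
  \<open>5 N\<^sub>0 + 5 N\<^sub>1 + N\<^sub>2 + N\<^sub>3 = 5\<close> for every \<open>y\<close>. If \<open>y\<close> has distance at least 3 from the code then
  \<open>N\<^sub>0 = N\<^sub>1 = N\<^sub>2 = 0\<close> and \<open>N\<^sub>3 = 5\<close>; if it has distance 2 then \<open>N\<^sub>2 = 1\<close>, since the minimum distance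
  is 5, and \<open>N\<^sub>3 = 4\<close>. The minimum distance comes from the same expansion at a codeword \<open>y\<close>, using
  the weight distribution \<open>1, 198, 495, 330\<close> of the dual code at the weights \<open>0, 6, 8, 10\<close>.
\<close>

section \<open>The symplectic form and its characters\<close>

text \<open>In terms of \<open>\<F>\<^sub>4\<close> this is the trace Hermitian form, the trace of \<open>u x\<^sup>2\<close>.\<close>

fun symplectic :: "gf4 \<Rightarrow> gf4 \<Rightarrow> bit" where
  "symplectic (GF4 a b) (GF4 c d) = a * d + b * c"

definition symplectic_form :: "gf4 ^ 'n \<Rightarrow> gf4 ^ 'n \<Rightarrow> bit" where
  "symplectic_form u x = (\<Sum>i\<in>UNIV. symplectic (u $ i) (x $ i))"

text \<open>The nontrivial character of F_2. The target ring is general because the values are taken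
  both in the integers and in integer polynomials.\<close>

definition bit_sign :: "bit \<Rightarrow> 'a :: comm_ring_1" where
  "bit_sign b = (if b = 0 then 1 else - 1)"

definition weight :: "'a :: zero ^ 'n \<Rightarrow> nat" where
  "weight u = card {i. u $ i \<noteq> 0}"

lemma weight_le_CARD: "weight (u :: 'a :: zero ^ 'n) \<le> CARD('n)"
  unfolding weight_def by (rule card_mono) auto

lemma bit_cases: "b = 0 \<or> b = 1" for b :: bit
  by (cases b) auto

lemma bit_sign_0 [simp]: "bit_sign 0 = 1"
  by (simp add: bit_sign_def)

lemma bit_sign_add: "bit_sign (a + b) = bit_sign a * bit_sign b"
  using bit_cases[of a] bit_cases[of b] by (auto simp: bit_sign_def)

lemma bit_sign_sum: "bit_sign (sum f A) = (\<Prod>i\<in>A. bit_sign (f i))"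
  by (induction A rule: infinite_finite_induct) (simp_all add: bit_sign_add del: add_bit_eq_xor)

lemma symplectic_add_left: "symplectic (u + v) x = symplectic u x + symplectic v x"
  \<comment> \<open>The default rules turn bit arithmetic into \<open>xor\<close> and
    \<open>and\<close>; without them it stays ring arithmetic.\<close>
  by (cases u; cases v; cases x)
    (simp del: add_bit_eq_xor mult_bit_eq_and add: algebra_simps)

lemma symplectic_add_right: "symplectic u (x + y) = symplectic u x + symplectic u y"
  by (cases u; cases x; cases y)
    (simp del: add_bit_eq_xor mult_bit_eq_and add: algebra_simps)

lemma symplectic_scale_right: "symplectic u (GF4 b 0 * x) = b * symplectic u x"
  by (cases u; cases x) (simp del: add_bit_eq_xor mult_bit_eq_and add: algebra_simps)

lemma symplectic_0_left [simp]: "symplectic 0 x = 0"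
  by (cases x) (simp add: zero_gf4_def)

lemma symplectic_0_right [simp]: "symplectic u 0 = 0"
  by (cases u) (simp add: zero_gf4_def)

lemma symplectic_form_0_left [simp]: "symplectic_form 0 x = 0"
  by (simp add: symplectic_form_def)

lemma symplectic_form_0_right [simp]: "symplectic_form u 0 = 0"
  by (simp add: symplectic_form_def)

lemma symplectic_form_add_left:
  "symplectic_form (u + v) x = symplectic_form u x + symplectic_form v x"
  by (simp add: symplectic_form_def symplectic_add_left sum.distrib del: add_bit_eq_xor)

lemma symplectic_form_add_right:
  "symplectic_form u (x + y) = symplectic_form u x + symplectic_form u y"
  by (simp add: symplectic_form_def symplectic_add_right sum.distrib del: add_bit_eq_xor)

lemma symplectic_form_scale_right:
  "symplectic_form u (f2_scale b x) = b * symplectic_form u x"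
  by (simp add: symplectic_form_def f2_scale_def symplectic_scale_right sum_distrib_left
      del: mult_bit_eq_and)

section \<open>Fourier transform of the Hamming distance enumerator\<close>

text \<open>For nonzero u the character is nontrivial and sums to 0 over F_4, so the three terms
  with a distinct from b add up to minus the term at b. For u = 0 these terms are z each.\<close>

lemma sum_gf4_symplectic:
  fixes z :: "'a :: comm_ring_1"
  shows "(\<Sum>a\<in>UNIV. bit_sign (symplectic u a) * (if b \<noteq> a then z else 1)) =
    bit_sign (symplectic u b) * (if u = 0 then 1 + 3 * z else 1 - z)"
proof -
  have U: "(UNIV :: gf4 set) = {GF4 0 0, GF4 0 1, GF4 1 0, GF4 1 1}"
    unfolding UNIV_gf4 by (auto simp: zero_gf4_def one_gf4_def \<omega>_def power2_eq_square)
  obtain p q r s where "u = GF4 p q" "b = GF4 r s"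
    by (metis gf4.exhaust)
  then show ?thesis
    unfolding U using bit_cases[of p] bit_cases[of q] bit_cases[of r] bit_cases[of s]
    by (elim disjE) (simp_all add: bit_sign_def zero_gf4_def)
qed

lemma sum_vec_prod:
  fixes f :: "'n :: finite \<Rightarrow> 'a :: finite \<Rightarrow> 'b :: comm_semiring_1"
  shows "(\<Sum>x\<in>UNIV. \<Prod>i\<in>UNIV. f i (x $ i)) = (\<Prod>i\<in>UNIV. \<Sum>a\<in>UNIV. f i a)"
proof -
  have "(\<Prod>i\<in>UNIV. \<Sum>a\<in>UNIV. f i a) = (\<Sum>g\<in>UNIV. \<Prod>i\<in>UNIV. f i (g i))"
    by (subst prod_sum_PiE) (simp_all add: PiE_UNIV_domain)
  also have "\<dots> = (\<Sum>x\<in>UNIV. \<Prod>i\<in>UNIV. f i (x $ i))"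
    by (rule sum.reindex_bij_witness[of _ vec_nth vec_lambda]) auto
  finally show ?thesis ..
qed

lemma prod_if_power_card:
  fixes y z :: "'b :: comm_semiring_1"
  shows "(\<Prod>i\<in>UNIV. if P i then z else y) =
    z ^ card {i :: 'n :: finite. P i} * y ^ (CARD('n) - card {i. P i})"
  by (simp add: prod.If_cases Compl_eq_Diff_UNIV card_Diff_subset)

text \<open>Character and distance power are both products over the coordinates, so the sum splits
  into one-coordinate sums.\<close>

lemma sum_symplectic_hamming:
  fixes z :: "'a :: comm_ring_1" and u y :: "gf4 ^ 'n"
  shows "(\<Sum>x\<in>UNIV. bit_sign (symplectic_form u x) * z ^ hamming_dist y x) =
    bit_sign (symplectic_form u y) * ((1 + 3 * z) ^ (CARD('n) - weight u) * (1 - z) ^ weight u)"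
proof -
  have "(\<Sum>x\<in>UNIV. bit_sign (symplectic_form u x) * z ^ hamming_dist y x) =
    (\<Sum>x\<in>UNIV. \<Prod>i\<in>UNIV. bit_sign (symplectic (u $ i) (x $ i)) *
       (if y $ i \<noteq> x $ i then z else 1))"
    by (simp only: symplectic_form_def bit_sign_sum prod.distrib prod_if_power_card
        hamming_dist_def) simp
  also have "\<dots> = (\<Prod>i\<in>UNIV. \<Sum>a\<in>UNIV. bit_sign (symplectic (u $ i) a) *
       (if y $ i \<noteq> a then z else 1))"
    by (rule sum_vec_prod)
  also have "\<dots> = (\<Prod>i\<in>UNIV. bit_sign (symplectic (u $ i) (y $ i)) *
       (if u $ i \<noteq> 0 then 1 - z else 1 + 3 * z))"
    unfolding sum_gf4_symplectic by (intro prod.cong) auto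
  also have "\<dots> = bit_sign (symplectic_form u y) *
      ((1 + 3 * z) ^ (CARD('n) - weight u) * (1 - z) ^ weight u)"
    by (simp only: symplectic_form_def bit_sign_sum prod.distrib prod_if_power_card weight_def
        mult.commute)
  finally show ?thesis .
qed

section \<open>The MacWilliams identity around an arbitrary centre\<close>

text \<open>The addition is a parameter so that one recursion serves vectors and coordinate lists.
  Words are listed with multiplicity, so the list has length \<open>2 ^ length hs\<close> even for
  dependent rows.\<close>

fun subset_sums :: "('a \<Rightarrow> 'a \<Rightarrow> 'a) \<Rightarrow> 'a \<Rightarrow> 'a list \<Rightarrow> 'a list" where
  "subset_sums f v [] = [v]"
| "subset_sums f v (h # hs) = subset_sums f v hs @ subset_sums f (f v h) hs"

definition symplectic_complement :: "(gf4 ^ 'n) set \<Rightarrow> (gf4 ^ 'n) set" where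
  "symplectic_complement H = {x. \<forall>h\<in>H. symplectic_form h x = 0}"

text \<open>Orthogonality of characters: the sum is the character of v times the product over h of
  (1 + character of h), and each such factor is 2 or 0.\<close>

lemma sum_list_bit_sign_subset_sums:
  "(\<Sum>u\<leftarrow>subset_sums (+) v hs. bit_sign (symplectic_form u x)) =
    (bit_sign (symplectic_form v x) *
      (if x \<in> symplectic_complement (set hs) then 2 ^ length hs else 0) :: 'a :: comm_ring_1)"
proof (induction hs arbitrary: v)
  case Nil
  then show ?case by (simp add: symplectic_complement_def)
next
  case (Cons h hs)
  then show ?case
    by (auto simp: symplectic_complement_def symplectic_form_add_left bit_sign_add
        simp del: add_bit_eq_xor) (auto simp: bit_sign_def)
qed

lemma symplectic_form_subset_sums:
  assumes "x \<in> symplectic_complement (set hs)" "symplectic_form v x = 0"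
    "u \<in> set (subset_sums (+) v hs)"
  shows "symplectic_form u x = 0"
  using assms
proof (induction hs arbitrary: v)
  case Nil
  then show ?case by simp
next
  case (Cons h hs)
  have "symplectic_form (v + h) x = 0"
    using Cons.prems by (simp add: symplectic_complement_def symplectic_form_add_left)
  then show ?case
    using Cons by (auto simp: symplectic_complement_def)
qed

text \<open>The ring is general so that z can be the polynomial variable, from which single
  distances are read off as coefficients.\<close>

lemma macwilliams_coset:
  fixes z :: "'a :: comm_ring_1" and y :: "gf4 ^ 'n"
  shows "2 ^ length hs * (\<Sum>c\<in>symplectic_complement (set hs). z ^ hamming_dist y c) =
    (\<Sum>u\<leftarrow>subset_sums (+) 0 hs. bit_sign (symplectic_form u y) *
      ((1 + 3 * z) ^ (CARD('n) - weight u) * (1 - z) ^ weight u))"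
proof -
  have "2 ^ length hs * (\<Sum>c\<in>symplectic_complement (set hs). z ^ hamming_dist y c) =
    (\<Sum>x\<in>UNIV. (\<Sum>u\<leftarrow>subset_sums (+) 0 hs. bit_sign (symplectic_form u x)) *
      z ^ hamming_dist y x)"
    by (simp add: sum_list_bit_sign_subset_sums sum_distrib_left if_distrib[of "\<lambda>t. t * _"]
        sum.If_cases cong: if_cong)
  also have "\<dots> = (\<Sum>u\<leftarrow>subset_sums (+) 0 hs.
      \<Sum>x\<in>UNIV. bit_sign (symplectic_form u x) * z ^ hamming_dist y x)"
    by (simp add: sum_list_sum_nth sum_distrib_right sum.swap[of _ UNIV])
  finally show ?thesis
    by (simp only: sum_symplectic_hamming)
qed

text \<open>The quaternary Krawtchouk polynomial of degree j at w, taken from its generating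
  function; in this form it can be evaluated by \<open>code_simp\<close>.\<close>

definition krawtchouk :: "nat \<Rightarrow> nat \<Rightarrow> nat \<Rightarrow> int" where
  "krawtchouk n w j = coeff ([:1, 3:] ^ (n - w) * [:1, - 1:] ^ w) j"

lemma card_sphere_symplectic_complement:
  fixes y :: "gf4 ^ 'n"
  shows "2 ^ length hs * int (card {c \<in> symplectic_complement (set hs). hamming_dist y c = j}) =
    (\<Sum>u\<leftarrow>subset_sums (+) 0 hs.
      bit_sign (symplectic_form u y) * krawtchouk CARD('n) (weight u) j)"
proof -
  let ?C = "symplectic_complement (set hs)"
  have mon: "[:0, 1:] ^ n = (monom 1 n :: int poly)" for n
    by (simp add: monom_altdef)
  have "coeff (\<Sum>c\<in>?C. [:0, 1:] ^ hamming_dist y c) j =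
      (\<Sum>c\<in>?C. if hamming_dist y c = j then 1 else (0 :: int))"
    by (simp add: mon coeff_sum)
  also have "\<dots> = int (card {c \<in> ?C. hamming_dist y c = j})"
    by (simp add: sum.If_cases Int_def)
  finally have *: "coeff (\<Sum>c\<in>?C. [:0, 1:] ^ hamming_dist y c) j =
      int (card {c \<in> ?C. hamming_dist y c = j})" .
  have two: "2 ^ n = ([:2 ^ n:] :: int poly)" for n
    by (induction n) (simp_all add: numeral_poly one_pCons)
  have sgn: "bit_sign b * p = smult (bit_sign b) p" for b and p :: "int poly"
    by (simp add: bit_sign_def)
  have fac: "1 + 3 * [:0, 1:] = ([:1, 3:] :: int poly)" "1 - [:0, 1:] = ([:1, - 1:] :: int poly)"
    by (simp_all add: numeral_poly one_pCons)
  have "2 ^ length hs * coeff (\<Sum>c\<in>?C. [:0, 1 :: int:] ^ hamming_dist y c) j =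
    coeff (2 ^ length hs * (\<Sum>c\<in>?C. [:0, 1:] ^ hamming_dist y c)) j"
    by (simp add: two)
  also have "\<dots> = coeff (\<Sum>u\<leftarrow>subset_sums (+) 0 hs. bit_sign (symplectic_form u y) *
      ([:1, 3:] ^ (CARD('n) - weight u) * [:1, - 1:] ^ weight u)) j"
    unfolding macwilliams_coset fac ..
  also have "\<dots> = (\<Sum>u\<leftarrow>subset_sums (+) 0 hs. coeff (bit_sign (symplectic_form u y) *
      ([:1, 3:] ^ (CARD('n) - weight u) * [:1, - 1:] ^ weight u)) j)"
    by (simp add: sum_list_sum_nth coeff_sum)
  also have "\<dots> = (\<Sum>u\<leftarrow>subset_sums (+) 0 hs.
      bit_sign (symplectic_form u y) * krawtchouk CARD('n) (weight u) j)"
    unfolding krawtchouk_def sgn by simp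
  finally show ?thesis
    unfolding * .
qed

section \<open>The dual code and its weight distribution\<close>

text \<open>A systematic binary basis: for each coordinate from 7 to 11, one row has
  \<open>\<omega>\<close> there, one has 1, and both vanish on the other four. Lists keep the weight
  enumeration executable.\<close>

definition dual_rows :: "gf4 list list" where
  "dual_rows =
    [[\<omega>, \<omega>, 1, 0, 1, \<omega>, \<omega>, 0, 0, 0, 0],
     [\<omega>\<^sup>2, 1, \<omega>, \<omega>\<^sup>2, 0, \<omega>, 1, 0, 0, 0, 0],
     [\<omega>\<^sup>2, \<omega>\<^sup>2, \<omega>, 1, \<omega>, 0, 0, \<omega>, 0, 0, 0],
     [\<omega>, 1, \<omega>, 0, \<omega>\<^sup>2, \<omega>\<^sup>2, 0, 1, 0, 0, 0],
     [\<omega>, \<omega>, \<omega>\<^sup>2, 1, \<omega>\<^sup>2, 0, 0, 0, \<omega>, 0, 0],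
     [\<omega>\<^sup>2, 0, \<omega>, \<omega>, \<omega>\<^sup>2, 1, 0, 0, 1, 0, 0],
     [0, \<omega>\<^sup>2, 1, \<omega>\<^sup>2, \<omega>, \<omega>, 0, 0, 0, \<omega>, 0],
     [1, \<omega>\<^sup>2, \<omega>, \<omega>, 0, \<omega>\<^sup>2, 0, 0, 0, 1, 0],
     [0, \<omega>, 1, \<omega>, \<omega>\<^sup>2, \<omega>\<^sup>2, 0, 0, 0, 0, \<omega>],
     [\<omega>\<^sup>2, \<omega>\<^sup>2, 0, \<omega>, 1, \<omega>, 0, 0, 0, 0, 1]]"

definition weight_indicator :: "'a :: zero list \<Rightarrow> int list" where
  "weight_indicator v = (replicate (Suc (length v)) 0)[length (filter (\<lambda>a. a \<noteq> 0) v) := 1]"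

text \<open>Merges weight histograms along the recursion of \<open>subset_sums\<close>, so that no
  list of words has to be built during evaluation.\<close>

fun weight_counts :: "'a :: monoid_add list \<Rightarrow> 'a list list \<Rightarrow> int list" where
  "weight_counts v [] = weight_indicator v"
| "weight_counts v (h # hs) = map2 (+) (weight_counts v hs) (weight_counts (map2 (+) v h) hs)"

lemma length_weight_counts:
  "\<forall>h\<in>set hs. length h = length v \<Longrightarrow> length (weight_counts v hs) = Suc (length v)"
  by (induction hs arbitrary: v) (simp_all add: weight_indicator_def del: replicate_Suc)

lemma nth_weight_counts:
  assumes "\<forall>h\<in>set hs. length h = length v" "w \<le> length v"
  shows "weight_counts v hs ! w =
    int (count_list (map (\<lambda>u. length (filter (\<lambda>a. a \<noteq> 0) u)) (subset_sums (map2 (+)) v hs)) w)"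
  using assms
proof (induction hs arbitrary: v)
  case Nil
  then show ?case
    by (auto simp: weight_indicator_def nth_list_update less_Suc_eq_le
        simp del: replicate_Suc)
next
  case (Cons h hs)
  then show ?case
    by (simp add: length_weight_counts)
qed

lemma length_subset_sums:
  assumes "\<forall>h\<in>set hs. length h = length v" "u \<in> set (subset_sums (map2 f) v hs)"
  shows "length u = length v"
  using assms
proof (induction hs arbitrary: v)
  case Nil
  then show ?case by simp
next
  case (Cons h hs)
  then show ?case
    using Cons.IH[of v] Cons.IH[of "map2 f v h"] by (simp; metis)
qed

text \<open>Enumerates all 1024 subset sums. The entry 1 at weight 0 shows that only the empty
  subset sums to zero.\<close>

lemma weight_counts_dual_rows:
  "weight_counts (replicate 11 0) dual_rows = [1, 0, 0, 0, 0, 0, 198, 0, 495, 0, 330, 0]"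
  by code_simp

lemma UNIV_11: "(UNIV :: 11 set) = {1, 2, 3, 4, 5, 6, 7, 8, 9, 10, 11}"
proof -
  have "x \<in> {1, 2, 3, 4, 5, 6, 7, 8, 9, 10, 11}" for x :: 11
  proof (induct x)
    case (of_int z)
    \<comment> \<open>The residue 0 is the element written 11.\<close>
    then have "z \<in> {0, 1, 2, 3, 4, 5, 6, 7, 8, 9, 10}" by simp presburger
    then show ?case by auto
  qed
  then show ?thesis by blast
qed

lemma sum_11:
  "(\<Sum>i\<in>UNIV. f i) = (\<Sum>i\<leftarrow>[1, 2, 3, 4, 5, 6, 7, 8, 9, 10, 11 :: 11]. f i)"
proof -
  let ?I = "[1, 2, 3, 4, 5, 6, 7, 8, 9, 10, 11 :: 11]"
  have I: "set ?I = UNIV"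
    by (simp only: UNIV_11 list.set)
  \<comment> \<open>Distinctness by counting: eleven entries cover a type with eleven
    elements.\<close>
  have "card (set ?I) = length ?I"
    unfolding I by simp
  then have "distinct ?I"
    by (rule card_distinct)
  then show ?thesis
    unfolding I[symmetric] by (rule sum_list_distinct_conv_sum_set[symmetric])
qed

lemma length_11_cases:
  assumes "length xs = 11"
  obtains x1 x2 x3 x4 x5 x6 x7 x8 x9 x10 x11
  where "xs = [x1, x2, x3, x4, x5, x6, x7, x8, x9, x10, x11]"
  using assms by (auto simp: eval_nat_numeral length_Suc_conv)

lemma vector_11_add:
  fixes xs ys :: "'a :: monoid_add list"
  assumes "length xs = 11" "length ys = 11"
  shows "(vector (map2 (+) xs ys) :: 'a ^ 11) = vector xs + vector ys"
proof -
  have "vector (map2 (+) xs ys) $ i = (vector xs + vector ys :: 'a ^ 11) $ i" for i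
    using UNIV_I[of i] assms
    by (auto simp: UNIV_11 vector_11 elim!: length_11_cases)
  then show ?thesis by (simp add: vec_eq_iff)
qed

lemma sum_vector_11:
  fixes f :: "'a :: zero \<Rightarrow> 'b :: comm_monoid_add"
  assumes "length xs = 11"
  shows "(\<Sum>i\<in>UNIV. f ((vector xs :: 'a ^ 11) $ i)) = sum_list (map f xs)"
  using assms by (elim length_11_cases) (simp add: sum_11 vector_11)

lemma weight_vector_11:
  fixes xs :: "'a :: zero list"
  assumes "length xs = 11"
  shows "weight (vector xs :: 'a ^ 11) = length (filter (\<lambda>a. a \<noteq> 0) xs)"
proof -
  have "weight (vector xs :: 'a ^ 11) = (\<Sum>i\<in>UNIV. of_bool ((vector xs :: 'a ^ 11) $ i \<noteq> 0))"
    by (simp add: weight_def)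
  also have "\<dots> = (\<Sum>a\<leftarrow>xs. of_bool (a \<noteq> 0))"
    using assms by (rule sum_vector_11)
  also have "\<dots> = length (filter (\<lambda>a. a \<noteq> 0) xs)"
    by (induction xs) simp_all
  finally show ?thesis .
qed

definition dual_basis :: "(gf4 ^ 11) list" where
  "dual_basis = map vector dual_rows"

lemma length_dual_rows: "h \<in> set dual_rows \<Longrightarrow> length h = 11"
  by (auto simp: dual_rows_def)

text \<open>Carries the enumeration from vectors over to executable lists.\<close>

lemma subset_sums_vector_11:
  assumes "length v = 11" "\<forall>h\<in>set hs. length h = 11"
  shows "subset_sums (+) (vector v :: 'a :: monoid_add ^ 11) (map vector hs) =
    map vector (subset_sums (map2 (+)) v hs)"
  using assms by (induction hs arbitrary: v) (simp_all flip: vector_11_add)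

lemma count_dual_weights:
  assumes "w \<le> 11"
  shows "int (count_list (map weight (subset_sums (+) 0 dual_basis)) w) =
    [1, 0, 0, 0, 0, 0, 198, 0, 495, 0, 330, 0] ! w"
proof -
  let ?L = "subset_sums (map2 (+)) (replicate 11 0) dual_rows"
  have "vector (replicate 11 0) = (0 :: gf4 ^ 11)"
  proof -
    have "vector (replicate 11 0) $ i = (0 :: gf4 ^ 11) $ i" for i
      using UNIV_I[of i] by (auto simp: UNIV_11 vector_11 numeral_eq_Suc)
    then show ?thesis by (simp add: vec_eq_iff)
  qed
  then have "subset_sums (+) 0 dual_basis = map vector ?L"
    unfolding dual_basis_def by (metis subset_sums_vector_11 length_dual_rows length_replicate)
  moreover have "\<forall>u\<in>set ?L. length u = 11"
    using length_subset_sums[of dual_rows "replicate 11 0"] length_dual_rows by auto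
  ultimately have "map weight (subset_sums (+) 0 dual_basis) =
      map (\<lambda>u. length (filter (\<lambda>a. a \<noteq> 0) u)) ?L"
    by (simp add: weight_vector_11)
  then show ?thesis
    using nth_weight_counts[of dual_rows "replicate 11 0" w] length_dual_rows assms
    by (simp add: weight_counts_dual_rows)
qed

lemma sum_list_map_eq_sum_count_list:
  fixes F :: "'a \<Rightarrow> 'b :: comm_semiring_1"
  assumes "finite A" "set xs \<subseteq> A"
  shows "sum_list (map F xs) = (\<Sum>x\<in>A. of_nat (count_list xs x) * F x)"
  using assms(2)
proof (induction xs)
  case Nil
  then show ?case by simp
next
  case (Cons a xs)
  have "(\<Sum>x\<in>A. of_nat (count_list (a # xs) x) * F x) =
      (\<Sum>x\<in>A. (if x = a then F x else 0) + of_nat (count_list xs x) * F x)"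
    by (intro sum.cong) (auto simp: algebra_simps)
  also have "\<dots> = F a + (\<Sum>x\<in>A. of_nat (count_list xs x) * F x)"
    using assms(1) Cons.prems by (simp add: sum.distrib)
  finally show ?case using Cons by simp
qed

lemma sum_list_dual_weights:
  fixes F :: "nat \<Rightarrow> int"
  shows "(\<Sum>u\<leftarrow>subset_sums (+) 0 dual_basis. F (weight u)) =
    F 0 + 198 * F 6 + 495 * F 8 + 330 * F 10"
proof -
  let ?ws = "map weight (subset_sums (+) 0 dual_basis)"
  have sub: "set ?ws \<subseteq> {..11}"
    using weight_le_CARD[where 'n = 11] by auto
  have "(\<Sum>u\<leftarrow>subset_sums (+) 0 dual_basis. F (weight u)) = sum_list (map F ?ws)"
    by (simp add: comp_def)
  also have "\<dots> = (\<Sum>w\<le>11. int (count_list ?ws w) * F w)"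
    using sub by (intro sum_list_map_eq_sum_count_list) simp_all
  also have "\<dots> = (\<Sum>w\<le>11. [1, 0, 0, 0, 0, 0, 198, 0, 495, 0, 330, 0] ! w * F w)"
    by (intro sum.cong) (simp_all add: count_dual_weights)
  also have "\<dots> = F 0 + 198 * F 6 + 495 * F 8 + 330 * F 10"
    by (simp add: numeral_eq_Suc)
  finally show ?thesis .
qed

section \<open>The code as a symplectic complement\<close>

text \<open>Oriented so that a check whose last summand is a bit of one of the coordinates 7 to 11
  becomes an equation solved for that bit.\<close>

lemma bit_add_eq_0_iff: "a + b = 0 \<longleftrightarrow> b = a" for a b :: bit
  using bit_cases[of a] bit_cases[of b] by auto

lemma bit_add_self: "a + a = 0" "a + (a + b) = b" for a b :: bit
  using bit_cases[of a] bit_cases[of b] by auto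

lemma symplectic_GF4:
  "symplectic 1 (GF4 a b) = b" "symplectic \<omega> (GF4 a b) = a" "symplectic (\<omega>\<^sup>2) (GF4 a b) = a + b"
  by (simp_all add: one_gf4_def \<omega>_def power2_eq_square del: add_bit_eq_xor mult_bit_eq_and)

lemma GF4_0_mult:
  "GF4 b 0 * 1 = GF4 b 0" "GF4 b 0 * \<omega> = GF4 0 b" "GF4 b 0 * \<omega>\<^sup>2 = GF4 b b"
  by (simp_all add: one_gf4_def \<omega>_def power2_eq_square del: add_bit_eq_xor mult_bit_eq_and)

lemma symplectic_form_11:
  fixes u :: "gf4 ^ 11"
  shows "symplectic_form u x = symplectic (u $ 1) (x $ 1) + symplectic (u $ 2) (x $ 2) +
    symplectic (u $ 3) (x $ 3) + symplectic (u $ 4) (x $ 4) + symplectic (u $ 5) (x $ 5) +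
    symplectic (u $ 6) (x $ 6) + symplectic (u $ 7) (x $ 7) + symplectic (u $ 8) (x $ 8) +
    symplectic (u $ 9) (x $ 9) + symplectic (u $ 10) (x $ 10) + symplectic (u $ 11) (x $ 11)"
  by (simp add: symplectic_form_def sum_11 add.assoc del: add_bit_eq_xor)

lemma D_generators_subset: "D_generators \<subseteq> symplectic_complement (set dual_basis)"
proof -
  have tab: "symplectic 1 1 = 0" "symplectic \<omega> \<omega> = 0" "symplectic (\<omega>\<^sup>2) (\<omega>\<^sup>2) = 0"
    "symplectic 1 \<omega> = 1" "symplectic \<omega> 1 = 1" "symplectic 1 (\<omega>\<^sup>2) = 1" "symplectic (\<omega>\<^sup>2) 1 = 1"
    "symplectic \<omega> (\<omega>\<^sup>2) = 1" "symplectic (\<omega>\<^sup>2) \<omega> = 1"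
    by (simp_all add: one_gf4_def \<omega>_def power2_eq_square)
  show ?thesis
    unfolding D_generators_def dual_basis_def dual_rows_def symplectic_complement_def
    by (simp add: symplectic_form_11 vector_11 tab)
qed

text \<open>One inclusion is a check on generators. For the other, every solution of the ten checks
  is written explicitly as a combination of the twelve generators.\<close>

lemma D_minus_eq: "D_minus = symplectic_complement (set dual_basis)"
proof
  have "f2.subspace (symplectic_complement (set dual_basis))"
    by (auto simp: f2.subspace_def symplectic_complement_def symplectic_form_add_right
        symplectic_form_scale_right)
  then show "D_minus \<subseteq> symplectic_complement (set dual_basis)"
    unfolding D_minus_def by (intro f2.span_minimal D_generators_subset)
next
  show "symplectic_complement (set dual_basis) \<subseteq> D_minus"
  proof
    fix x assume x: "x \<in> symplectic_complement (set dual_basis)"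
    obtain a1 b1 where x1: "x $ 1 = GF4 a1 b1" by (cases "x $ 1")
    obtain a2 b2 where x2: "x $ 2 = GF4 a2 b2" by (cases "x $ 2")
    obtain a3 b3 where x3: "x $ 3 = GF4 a3 b3" by (cases "x $ 3")
    obtain a4 b4 where x4: "x $ 4 = GF4 a4 b4" by (cases "x $ 4")
    obtain a5 b5 where x5: "x $ 5 = GF4 a5 b5" by (cases "x $ 5")
    obtain a6 b6 where x6: "x $ 6 = GF4 a6 b6" by (cases "x $ 6")
    obtain a7 b7 where x7: "x $ 7 = GF4 a7 b7" by (cases "x $ 7")
    obtain a8 b8 where x8: "x $ 8 = GF4 a8 b8" by (cases "x $ 8")
    obtain a9 b9 where x9: "x $ 9 = GF4 a9 b9" by (cases "x $ 9")
    obtain a10 b10 where x10: "x $ 10 = GF4 a10 b10" by (cases "x $ 10")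
    obtain a11 b11 where x11: "x $ 11 = GF4 a11 b11" by (cases "x $ 11")
    note xs = x1 x2 x3 x4 x5 x6 x7 x8 x9 x10 x11
    \<comment> \<open>The last ten generators have a single entry 1 or \<open>\<omega>\<close> on
      coordinates 1 to 5, so their coefficients are the bits of x there. The first two vanish on
      these coordinates and have \<open>\<omega>\<^sup>2\<close> and \<open>\<omega>\<close> at
      coordinate 6; their coefficients are solved from a6 and b6.\<close>
    let ?y = "f2_scale (a1 + b2 + b4 + a5 + a6) (vector [0, 0, 0, 0, 0, \<omega>\<^sup>2, \<omega>\<^sup>2, 0, \<omega>, 1, \<omega>]) +
      f2_scale (a1 + a3 + b3 + a4 + b5 + a6 + b6) (vector [0, 0, 0, 0, 0, \<omega>, 0, \<omega>, \<omega>, \<omega>, 1]) +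
      f2_scale a1 (vector [1, 0, 0, 0, 0, 1, 0, 1, \<omega>\<^sup>2, \<omega>\<^sup>2, 1]) +
      f2_scale b1 (vector [\<omega>, 0, 0, 0, 0, 0, \<omega>, 1, \<omega>, \<omega>, \<omega>]) +
      f2_scale a2 (vector [0, 1, 0, 0, 0, 0, 1, 1, 1, \<omega>\<^sup>2, \<omega>\<^sup>2]) +
      f2_scale b2 (vector [0, \<omega>, 0, 0, 0, \<omega>\<^sup>2, 1, \<omega>\<^sup>2, \<omega>, \<omega>, 0]) +
      f2_scale a3 (vector [0, 0, 1, 0, 0, \<omega>, \<omega>, 1, 1, 0, 1]) +
      f2_scale b3 (vector [0, 0, \<omega>, 0, 0, \<omega>, 1, \<omega>, \<omega>\<^sup>2, \<omega>\<^sup>2, 0]) +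
      f2_scale a4 (vector [0, 0, 0, 1, 0, \<omega>, \<omega>, \<omega>, 0, 1, \<omega>]) +
      f2_scale b4 (vector [0, 0, 0, \<omega>, 0, \<omega>\<^sup>2, 1, 1, \<omega>\<^sup>2, 0, \<omega>]) +
      f2_scale a5 (vector [0, 0, 0, 0, 1, \<omega>\<^sup>2, \<omega>\<^sup>2, \<omega>\<^sup>2, 1, 0, \<omega>\<^sup>2]) +
      f2_scale b5 (vector [0, 0, 0, 0, \<omega>, \<omega>, 1, 0, 1, \<omega>, \<omega>])"
    \<comment> \<open>Each check has exactly one nonzero bit among the coordinates 7 to 11, so it expresses this
      bit of \<open>x\<close> by the bits of the coordinates 1 to 6.\<close>
    have eqs: "a7 = a1 + a2 + b3 + b5 + a6"
      "b7 = (a1 + b1) + b2 + a3 + (a4 + b4) + a6"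
      "a8 = (a1 + b1) + (a2 + b2) + a3 + b4 + a5"
      "b8 = a1 + b2 + a3 + (a5 + b5) + (a6 + b6)"
      "a9 = a1 + a2 + (a3 + b3) + b4 + (a5 + b5)"
      "b9 = (a1 + b1) + a3 + a4 + (a5 + b5) + b6"
      "a10 = (a2 + b2) + b3 + (a4 + b4) + a5 + a6"
      "b10 = b1 + (a2 + b2) + a3 + a4 + (a6 + b6)"
      "a11 = a2 + b3 + a4 + (a5 + b5) + (a6 + b6)"
      "b11 = (a1 + b1) + (a2 + b2) + a4 + b5 + a6"
      using x by (simp_all only: dual_basis_def dual_rows_def symplectic_complement_def
          symplectic_form_11 vector_11 list.map list.set mem_Collect_eq ball_simps xs
          symplectic_0_left symplectic_GF4 add_0_left add_0_right simp_thms)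
        (simp_all only: bit_add_eq_0_iff)
    \<comment> \<open>Coordinates 1 to 6 agree by the choice of coefficients, the others by the
      checks.\<close>
    have "x $ i = ?y $ i" for i
      using UNIV_I[of i] unfolding UNIV_11 insert_iff empty_iff
      by (elim disjE FalseE; hypsubst)
        (simp_all add: vector_11 xs f2_scale_def GF4_0_mult zero_gf4_def eqs bit_add_self add_ac
         del: add_bit_eq_xor mult_bit_eq_and)
    then have "x = ?y" by (simp only: vec_eq_iff simp_thms)
    also have "?y \<in> f2.span D_generators"
      by (intro f2.span_add f2.span_scale f2.span_base)
        (simp_all only: D_generators_def insert_iff simp_thms)
    finally show "x \<in> D_minus"
      unfolding D_minus_def .
  qed
qed

lemma weight_eq_0_iff: "weight u = 0 \<longleftrightarrow> u = 0"
  by (auto simp: weight_def vec_eq_iff)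

lemma dual_weights:
  assumes "u \<in> set (subset_sums (+) 0 dual_basis)"
  shows "weight u \<in> {0, 6, 8, 10}"
proof -
  have le: "weight u \<le> 11"
    using weight_le_CARD[of u] by simp
  have "count_list (map weight (subset_sums (+) 0 dual_basis)) (weight u) \<noteq> 0"
    using assms by (simp add: count_list_0_iff)
  then have "[1, 0, 0, 0, 0, 0, 198, 0, 495, 0, 330, 0 :: int] ! weight u \<noteq> 0"
    unfolding count_dual_weights[OF le, symmetric] by simp
  moreover have "weight u \<in> {0, 1, 2, 3, 4, 5, 6, 7, 8, 9, 10, 11}"
    using le by (simp, presburger)
  ultimately show ?thesis
    by auto
qed

section \<open>Sphere counts from the dual weights\<close>

lemma card_sphere_D_minus:
  "1024 * int (card {c \<in> D_minus. hamming_dist y c = j}) =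
    (\<Sum>u\<leftarrow>subset_sums (+) 0 dual_basis.
      bit_sign (symplectic_form u y) * krawtchouk 11 (weight u) j)"
proof -
  have "length dual_basis = 10"
    by (simp add: dual_basis_def dual_rows_def)
  then show ?thesis
    using card_sphere_symplectic_complement[of dual_basis y j] by (simp add: D_minus_eq)
qed

lemma D_minus_sphere_relation:
  fixes y :: "gf4 ^ 11"
  defines "N \<equiv> \<lambda>j. card {c \<in> D_minus. hamming_dist y c = j}"
  shows "5 * N 0 + 5 * N 1 + N 2 + N 3 = 5"
proof -
  \<comment> \<open>The cubic in \<open>w\<close> that vanishes at the three nonzero dual weights, in the Krawtchouk basis.\<close>
  define \<beta> where
    "\<beta> w = 5 * krawtchouk 11 w 0 + 5 * krawtchouk 11 w 1 + krawtchouk 11 w 2 + krawtchouk 11 w 3"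
    for w
  \<comment> \<open>5120 is 5 times the normalising factor 1024, which produces the 5 on the
    right-hand side.\<close>
  have \<beta>: "\<beta> 0 = 5120" "\<beta> 6 = 0" "\<beta> 8 = 0" "\<beta> 10 = 0"
    unfolding \<beta>_def by code_simp+
  \<comment> \<open>The sign carries all dependence on y. It is 1 for the zero word, and for the
    other dual words it multiplies 0.\<close>
  have sgn: "bit_sign (symplectic_form u y) * \<beta> (weight u) = \<beta> (weight u)"
    if "u \<in> set (subset_sums (+) 0 dual_basis)" for u
    using dual_weights[OF that] \<beta> weight_eq_0_iff[of u] by auto
  have N: "1024 * int (N j) = (\<Sum>u\<leftarrow>subset_sums (+) 0 dual_basis.
      bit_sign (symplectic_form u y) * krawtchouk 11 (weight u) j)" for j
    unfolding N_def by (rule card_sphere_D_minus)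
  have "1024 * (5 * int (N 0) + 5 * int (N 1) + int (N 2) + int (N 3)) =
    (\<Sum>u\<leftarrow>subset_sums (+) 0 dual_basis.
      bit_sign (symplectic_form u y) * \<beta> (weight u))"
    using N[of 0] N[of 1] N[of 2] N[of 3]
    by (simp add: \<beta>_def algebra_simps sum_list_addf sum_list_const_mult)
  also have "\<dots> = (\<Sum>u\<leftarrow>subset_sums (+) 0 dual_basis. \<beta> (weight u))"
    by (intro arg_cong[where f = sum_list] map_cong refl sgn)
  also have "\<dots> = 5120"
    unfolding sum_list_dual_weights by (simp add: \<beta>)
  finally have "int (5 * N 0 + 5 * N 1 + N 2 + N 3) = int 5" by simp
  then show ?thesis by (simp only: of_nat_eq_iff)
qed

text \<open>All checks vanish on a codeword, so every sign is 1 and the classical MacWilliams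
  transform of the dual weight distribution remains.\<close>

lemma card_sphere_codeword:
  assumes "y \<in> D_minus"
  shows "1024 * int (card {c \<in> D_minus. hamming_dist y c = j}) =
    krawtchouk 11 0 j + 198 * krawtchouk 11 6 j + 495 * krawtchouk 11 8 j + 330 * krawtchouk 11 10 j"
proof -
  have "bit_sign (symplectic_form u y) * krawtchouk 11 (weight u) j = krawtchouk 11 (weight u) j"
    if "u \<in> set (subset_sums (+) 0 dual_basis)" for u
    using symplectic_form_subset_sums[OF assms[unfolded D_minus_eq] _ that] by simp
  then have "1024 * int (card {c \<in> D_minus. hamming_dist y c = j}) =
      (\<Sum>u\<leftarrow>subset_sums (+) 0 dual_basis. krawtchouk 11 (weight u) j)"
    unfolding card_sphere_D_minus by (intro arg_cong[where f = sum_list] map_cong refl)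
  then show ?thesis
    by (simp only: sum_list_dual_weights[of "\<lambda>w. krawtchouk 11 w j"])
qed

section \<open>Minimum distance and uniform packing\<close>

lemma hamming_dist_eq_0_iff: "hamming_dist x y = 0 \<longleftrightarrow> x = y"
  by (auto simp: hamming_dist_def vec_eq_iff)

lemma hamming_dist_commute: "hamming_dist x y = hamming_dist y x"
  unfolding hamming_dist_def by (metis (full_types))

lemma hamming_dist_triangle: "hamming_dist x z \<le> hamming_dist x y + hamming_dist y z"
proof -
  have "{i. x $ i \<noteq> z $ i} \<subseteq> {i. x $ i \<noteq> y $ i} \<union> {i. y $ i \<noteq> z $ i}"
    by auto
  then have "card {i. x $ i \<noteq> z $ i} \<le> card ({i. x $ i \<noteq> y $ i} \<union> {i. y $ i \<noteq> z $ i})"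
    by (intro card_mono) auto
  also have "\<dots> \<le> card {i. x $ i \<noteq> y $ i} + card {i. y $ i \<noteq> z $ i}"
    by (rule card_Un_le)
  finally show ?thesis
    by (simp add: hamming_dist_def)
qed

text \<open>The transform of the dual weight distribution vanishes at 1, 2, 3 and 4, so the spheres
  of these radii around a codeword contain no codeword.\<close>

lemma D_minus_distance:
  assumes "x \<in> D_minus" "y \<in> D_minus" "x \<noteq> y"
  shows "hamming_dist x y \<ge> 5"
proof (rule ccontr)
  assume "\<not> ?thesis"
  moreover have "hamming_dist x y \<noteq> 0"
    using assms by (simp add: hamming_dist_eq_0_iff)
  ultimately have "hamming_dist x y \<in> {1, 2, 3, 4}"
    by auto
  moreover have "\<forall>j\<in>{1, 2, 3, 4}. krawtchouk 11 0 j + 198 * krawtchouk 11 6 j +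
      495 * krawtchouk 11 8 j + 330 * krawtchouk 11 10 j = 0"
    by code_simp
  ultimately have "1024 * int (card {c \<in> D_minus. hamming_dist x c = hamming_dist x y}) = 0"
    unfolding card_sphere_codeword[OF assms(1)] by blast
  then have "card {c \<in> D_minus. hamming_dist x c = hamming_dist x y} = 0"
    by linarith
  then show False
    using assms(2) by auto
qed

lemma zero_in_D_minus: "0 \<in> D_minus"
  unfolding D_minus_def by (rule f2.span_zero)

lemma min_distance_D_minus: "min_distance D_minus = 5"
proof -
  \<comment> \<open>A nonzero transform at 5 yields a codeword of weight 5, so the bound is
    attained.\<close>
  have "krawtchouk 11 0 5 + 198 * krawtchouk 11 6 5 + 495 * krawtchouk 11 8 5 +
      330 * krawtchouk 11 10 5 \<noteq> 0"
    by code_simp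
  then have "card {c \<in> D_minus. hamming_dist 0 c = 5} \<noteq> 0"
    unfolding card_sphere_codeword[OF zero_in_D_minus, of 5, symmetric] by linarith
  then obtain c where c: "c \<in> D_minus" "hamming_dist 0 c = 5"
    by (metis (mono_tags, lifting) Collect_empty_eq card.empty)
  then have "0 \<noteq> c"
    using hamming_dist_eq_0_iff[of 0 c] by auto
  with c zero_in_D_minus
  have "5 \<in> {hamming_dist x y |x y. x \<in> D_minus \<and> y \<in> D_minus \<and> x \<noteq> y}"
    by (intro CollectI exI[of _ 0] exI[of _ c]) simp
  then show ?thesis
    unfolding min_distance_def
    by (rule cInf_eq_minimum) (auto intro: D_minus_distance)
qed

lemma D_minus_uniformly_packed:
  fixes x :: "gf4 ^ 11"
  shows "dist_to_code x D_minus = 2 \<Longrightarrow> card {c \<in> D_minus. hamming_dist x c = 3} = 4"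
    and "dist_to_code x D_minus \<ge> 3 \<Longrightarrow> card {c \<in> D_minus. hamming_dist x c = 3} = 5"
proof -
  have low: "card {c \<in> D_minus. hamming_dist x c = j} = 0" if "j < dist_to_code x D_minus" for j
  proof -
    have "dist_to_code x D_minus \<le> hamming_dist x c" if "c \<in> D_minus" for c
      unfolding dist_to_code_def using that by (intro cINF_lower) auto
    then have "{c \<in> D_minus. hamming_dist x c = j} = {}"
      using that by (auto simp: not_less[symmetric])
    then show ?thesis by (simp only: card.empty)
  qed
  show "card {c \<in> D_minus. hamming_dist x c = 3} = 5" if "dist_to_code x D_minus \<ge> 3"
  proof -
    have "card {c \<in> D_minus. hamming_dist x c = 0} = 0"
      "card {c \<in> D_minus. hamming_dist x c = 1} = 0"
      "card {c \<in> D_minus. hamming_dist x c = 2} = 0"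
      using that by (intro low; simp)+
    then show ?thesis
      using D_minus_sphere_relation[of x] by linarith
  qed
  show "card {c \<in> D_minus. hamming_dist x c = 3} = 4" if d: "dist_to_code x D_minus = 2"
  proof -
    have "dist_to_code x D_minus \<in> hamming_dist x ` D_minus"
      unfolding dist_to_code_def using zero_in_D_minus by (intro Inf_nat_def1) auto
    then obtain c where c: "c \<in> D_minus" "hamming_dist x c = 2"
      using d by auto
    \<comment> \<open>Two codewords at distance 2 from x are within distance 4 of each other, below
      the minimum distance 5.\<close>
    have "c' = c" if c': "c' \<in> D_minus" "hamming_dist x c' = 2" for c'
      using D_minus_distance[OF c'(1) c(1)] hamming_dist_triangle[of c' c x] c'(2) c(2)
      by (auto simp: hamming_dist_commute[of _ x])
    then have "{c \<in> D_minus. hamming_dist x c = 2} = {c}"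
      using c by blast
    then have "card {c \<in> D_minus. hamming_dist x c = 2} = 1"
      by simp
    moreover have "card {c \<in> D_minus. hamming_dist x c = 0} = 0"
      "card {c \<in> D_minus. hamming_dist x c = 1} = 0"
      using d by (intro low; simp)+
    ultimately show ?thesis
      using D_minus_sphere_relation[of x] by linarith
  qed
qed

theorem theorem4:
  shows "min_distance D_minus = 5 \<and> packing_radius D_minus = 2 \<and>
    uniformly_packed D_minus 4 5 \<and>
    (\<forall>x :: gf4 ^ 11.
       (dist_to_code x D_minus = 2 \<longrightarrow> card {c \<in> D_minus. hamming_dist x c = 3} = 4) \<and>
       (dist_to_code x D_minus \<ge> 3 \<longrightarrow> card {c \<in> D_minus. hamming_dist x c = 3} = 5))"
proof -
  have "packing_radius D_minus = 2"
    by (simp add: packing_radius_def min_distance_D_minus)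
  \<comment> \<open>Identifies the radius e + 1 in \<open>uniformly_packed\<close> with 3.\<close>
  moreover have "2 + 1 = (3 :: nat)" by simp
  ultimately show ?thesis
    unfolding uniformly_packed_def Let_def
    using D_minus_uniformly_packed min_distance_D_minus by simp
qed

end
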